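(* Let $k\ge 1$ and $N\ge 2k+1$ be integers, let $\lambda_1,\dots,\lambda_k$ be real numbers with $|\lambda_j|<1$ for all $j$, and let $H=H^{(N)}(\lambda_1,\dots,\lambda_k)$ be the real tridiagonal $N\times N$ matrix and $\Theta^{(diag)}$ the diagonal matrix defined in the context. Put $f(x):=(1-x)/(1+x)$, and let $\mathcal{P}$ be the real symmetric $N\times N$ matrix whose only nonzero entries lie on the first upper and first lower diagonals, where $$\mathcal{P}_{j,j+1}=\mathcal{P}_{j+1,j}=\mathcal{P}_{N-j,\,N+1-j}=\mathcal{P}_{N+1-j,\,N-j}=(1+\lambda_j)\prod_{i=j}^{k} f(\lambda_i),\qquad j=1,\dots,k,$$ and $\mathcal{P}_{j,j+1}=\mathcal{P}_{j+1,j}=1$ for $k<j<N-k$. For real $v$ put $\Theta^{(tridiag)}=\Theta^{(diag)}+v\,\mathcal{P}$. Then for every real $v$ for which $\Theta^{(tridiag)}$ is positive definite, $H$ is self-adjoint in the Hilbert space $\mathbb{R}^N$ equipped with the inner product $\langle\psi|\phi\rangle^{(S)}=\psi^{T}\Theta^{(tridiag)}\phi$; that is, $H^{T}\Theta^{(tridiag)}=\Theta^{(tridiag)}H$. Moreover, there exist values $v\neq 0$ for which $\Theta^{(tridiag)}$ is positive definite (and for $v\ne0$ one has $\Theta^{(tridiag)}\neq I$).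
   Context: For integers $k\ge1$, $N\ge 2k+1$ and real $\lambda_1,\dots,\lambda_k$, the matrix $H=H^{(N)}(\lambda_1,\dots,\lambda_k)$ is the real $N\times N$ tridiagonal matrix (all entries $H_{ij}$ with $|i-j|>1$ are zero) with $H_{jj}=2$ for all $j=1,\dots,N$; with $$H_{j,j+1}=-1-\lambda_j,\quad H_{j+1,j}=-1+\lambda_j,\quad H_{N-j,\,N-j+1}=-1+\lambda_j,\quad H_{N-j+1,\,N-j}=-1-\lambda_j\qquad (j=1,\dots,k);$$ and with all remaining entries of the first upper and first lower diagonals (i.e. $H_{j,j+1}$ and $H_{j+1,j}$ for $k<j<N-k$) equal to $-1$. With $f(x)=(1-x)/(1+x)$, $\Theta^{(diag)}$ is the diagonal $N\times N$ matrix with $\Theta^{(diag)}_{jj}=\Theta^{(diag)}_{N+1-j,\,N+1-j}=\prod_{i=j}^{k} f(\lambda_i)$ for $j=1,\dots,k$ and $\Theta^{(diag)}_{jj}=1$ for $k<j\le N-k$. A metric is a symmetric positive definite matrix $\Theta$. A real matrix $H$ is self-adjoint with respect to the inner product $\langle\psi|\phi\rangle^{(S)}=\psi^T\Theta\phi$ if $\langle\psi|H\phi\rangle^{(S)}=\langle H\psi|\phi\rangle^{(S)}$ for all $\psi,\phi\in\mathbb{R}^N$, equivalently $H^T\Theta=\Theta H$. *)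

theory Defs
  imports Complex_Main "Jordan_Normal_Form.Matrix"
begin

text \<open>
  Matrices are 0-based, whereas all families of coefficients below are 1-based as in the usual
  mathematical notation: \<open>d m\<close> is the entry at \<open>(m, m)\<close>, \<open>u m\<close> the entry at \<open>(m, m+1)\<close> and
  \<open>l m\<close> the entry at \<open>(m+1, m)\<close>.
\<close>

definition tridiag_mat ::
  "nat \<Rightarrow> (nat \<Rightarrow> real) \<Rightarrow> (nat \<Rightarrow> real) \<Rightarrow> (nat \<Rightarrow> real) \<Rightarrow> real mat" where
  "tridiag_mat N d u l = mat N N (\<lambda>(i, j).
     if i = j then d (i + 1)
     else if j = i + 1 then u (i + 1)
     else if i = j + 1 then l (j + 1)
     else 0)"

text \<open>
  In the next definitions \<open>m\<close> is the position on the (sub-, super-)diagonal.  The coefficients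
  prescribed at position \<open>m = N - j\<close> (resp. \<open>m = N + 1 - j\<close> on the main diagonal) for
  \<open>1 \<le> j \<le> k\<close> are obtained by solving for \<open>j\<close>; since \<open>N \<ge> 2 * k + 1\<close>,
  the cases do not overlap.
\<close>

definition Hmat :: "nat \<Rightarrow> nat \<Rightarrow> (nat \<Rightarrow> real) \<Rightarrow> real mat" where
  "Hmat N k lam = tridiag_mat N
     (\<lambda>m. 2)
     (\<lambda>m. if m \<le> k then - 1 - lam m else if N - m \<le> k then - 1 + lam (N - m) else - 1)
     (\<lambda>m. if m \<le> k then - 1 + lam m else if N - m \<le> k then - 1 - lam (N - m) else - 1)"

definition f_fun :: "real \<Rightarrow> real" where
  "f_fun x = (1 - x) / (1 + x)"

definition Theta_diag :: "nat \<Rightarrow> nat \<Rightarrow> (nat \<Rightarrow> real) \<Rightarrow> real mat" where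
  "Theta_diag N k lam = tridiag_mat N
     (\<lambda>m. if m \<le> k then \<Prod>i=m..k. f_fun (lam i)
          else if N + 1 - m \<le> k then \<Prod>i=N + 1 - m..k. f_fun (lam i)
          else 1)
     (\<lambda>m. 0) (\<lambda>m. 0)"

definition P_coeff :: "nat \<Rightarrow> nat \<Rightarrow> (nat \<Rightarrow> real) \<Rightarrow> nat \<Rightarrow> real" where
  "P_coeff N k lam m =
     (if m \<le> k then (1 + lam m) * (\<Prod>i=m..k. f_fun (lam i))
      else if N - m \<le> k then (1 + lam (N - m)) * (\<Prod>i=N - m..k. f_fun (lam i))
      else 1)"

definition Pmat :: "nat \<Rightarrow> nat \<Rightarrow> (nat \<Rightarrow> real) \<Rightarrow> real mat" where
  "Pmat N k lam = tridiag_mat N (\<lambda>m. 0) (P_coeff N k lam) (P_coeff N k lam)"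

definition Theta_tridiag :: "nat \<Rightarrow> nat \<Rightarrow> (nat \<Rightarrow> real) \<Rightarrow> real \<Rightarrow> real mat" where
  "Theta_tridiag N k lam v = Theta_diag N k lam + v \<cdot>\<^sub>m Pmat N k lam"

definition inner_S :: "real mat \<Rightarrow> real vec \<Rightarrow> real vec \<Rightarrow> real" where
  "inner_S \<Theta> \<psi> \<phi> = \<psi> \<bullet> (\<Theta> *\<^sub>v \<phi>)"

definition positive_definite :: "nat \<Rightarrow> real mat \<Rightarrow> bool" where
  "positive_definite N \<Theta> \<longleftrightarrow>
     \<Theta> \<in> carrier_mat N N \<and> (\<forall>\<psi> \<in> carrier_vec N. \<psi> \<noteq> 0\<^sub>v N \<longrightarrow> \<psi> \<bullet> (\<Theta> *\<^sub>v \<psi>) > 0)"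

definition is_metric :: "nat \<Rightarrow> real mat \<Rightarrow> bool" where
  "is_metric N \<Theta> \<longleftrightarrow> \<Theta>\<^sup>T = \<Theta> \<and> positive_definite N \<Theta>"

definition self_adjoint_wrt :: "nat \<Rightarrow> real mat \<Rightarrow> real mat \<Rightarrow> bool" where
  "self_adjoint_wrt N \<Theta> H \<longleftrightarrow>
     (\<forall>\<psi> \<in> carrier_vec N. \<forall>\<phi> \<in> carrier_vec N.
        inner_S \<Theta> \<psi> (H *\<^sub>v \<phi>) = inner_S \<Theta> (H *\<^sub>v \<psi>) \<phi>)"

end

theory Submission
  imports Defs
begin

text \<open>
  The diagonal part \<open>D\<close> of the metric satisfies \<open>D H = 2 D - P\<close>. Hence \<open>D H\<close> is symmetric, that is,
  \<open>H\<^sup>T D = D H\<close>, and \<open>D + v P = D ((1 + 2 v) - v H)\<close> is \<open>D\<close> times a polynomial in \<open>H\<close>, so it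
  intertwines \<open>H\<close> with \<open>H\<^sup>T\<close> as well.
  Positivity for small \<open>v\<close> holds because \<open>D\<close> is diagonal with positive entries.
\<close>

section \<open>Tridiagonal matrices: entries, transposes and diagonal scaling\<close>

lemma tridiag_mat_carrier [simp]: "tridiag_mat N d u l \<in> carrier_mat N N"
  by (simp add: tridiag_mat_def)

lemma tridiag_mat_dims [simp]:
  "dim_row (tridiag_mat N d u l) = N" "dim_col (tridiag_mat N d u l) = N"
  by (simp_all add: tridiag_mat_def)

lemma index_tridiag_mat:
  assumes "i < N" "j < N"
  shows "tridiag_mat N d u l $$ (i, j) =
     (if i = j then d (i + 1) else if j = i + 1 then u (i + 1)
      else if i = j + 1 then l (j + 1) else 0)"
  using assms by (simp add: tridiag_mat_def)

lemma transpose_tridiag_mat: "(tridiag_mat N d u l)\<^sup>T = tridiag_mat N d l u"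
  by (rule eq_matI) (auto simp: index_tridiag_mat)

lemma diag_mult_index:
  assumes "i < N" "j < N" "A \<in> carrier_mat N N"
  shows "(tridiag_mat N d (\<lambda>m. 0) (\<lambda>m. 0) * A) $$ (i, j) = d (i + 1) * A $$ (i, j)"
proof -
  have "(tridiag_mat N d (\<lambda>m. 0) (\<lambda>m. 0) * A) $$ (i, j) =
      (\<Sum>n = 0..<N. tridiag_mat N d (\<lambda>m. 0) (\<lambda>m. 0) $$ (i, n) * A $$ (n, j))"
    using assms by (simp add: scalar_prod_def)
  also have "\<dots> = (\<Sum>n = 0..<N. if n = i then d (i + 1) * A $$ (i, j) else 0)"
    using assms by (intro sum.cong) (auto simp: index_tridiag_mat)
  also have "\<dots> = d (i + 1) * A $$ (i, j)"
    using assms by simp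
  finally show ?thesis .
qed

section \<open>Quadratic forms and positivity under small perturbations\<close>

lemma quadratic_form_eq_sum:
  fixes A :: "real mat"
  assumes "A \<in> carrier_mat N N" "\<psi> \<in> carrier_vec N"
  shows "\<psi> \<bullet> (A *\<^sub>v \<psi>) = (\<Sum>i<N. \<Sum>j<N. A $$ (i, j) * (\<psi> $ i * \<psi> $ j))"
  using assms
  by (auto simp: scalar_prod_def sum_distrib_left atLeast0LessThan algebra_simps intro!: sum.cong)

text \<open>Each product of two coordinates is at most half the sum of their squares. In the double
  sum every square then occurs \<open>N\<close> times through the row index and \<open>N\<close>
  times through the column index, each time with weight \<open>B / 2\<close>.\<close>

lemma abs_quadratic_form_le:
  fixes A :: "real mat"
  assumes A: "A \<in> carrier_mat N N" and \<psi>: "\<psi> \<in> carrier_vec N"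
    and B: "\<And>i j. i < N \<Longrightarrow> j < N \<Longrightarrow> \<bar>A $$ (i, j)\<bar> \<le> B"
  shows "\<bar>\<psi> \<bullet> (A *\<^sub>v \<psi>)\<bar> \<le> real N * B * (\<Sum>i<N. (\<psi> $ i)\<^sup>2)"
proof -
  have entry: "\<bar>A $$ (i, j) * (\<psi> $ i * \<psi> $ j)\<bar> \<le> B / 2 * ((\<psi> $ i)\<^sup>2 + (\<psi> $ j)\<^sup>2)"
    if "i < N" "j < N" for i j
  proof -
    have "\<bar>\<psi> $ i * \<psi> $ j\<bar> \<le> ((\<psi> $ i)\<^sup>2 + (\<psi> $ j)\<^sup>2) / 2"
      using sum_squares_bound[of "\<bar>\<psi> $ i\<bar>" "\<bar>\<psi> $ j\<bar>"] by (simp add: abs_mult)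
    then have "\<bar>A $$ (i, j)\<bar> * \<bar>\<psi> $ i * \<psi> $ j\<bar> \<le> B * (((\<psi> $ i)\<^sup>2 + (\<psi> $ j)\<^sup>2) / 2)"
      using B[OF that] by (intro mult_mono) auto
    then show ?thesis by (simp add: abs_mult)
  qed
  have "\<bar>\<psi> \<bullet> (A *\<^sub>v \<psi>)\<bar> \<le> (\<Sum>i<N. \<bar>\<Sum>j<N. A $$ (i, j) * (\<psi> $ i * \<psi> $ j)\<bar>)"
    unfolding quadratic_form_eq_sum[OF A \<psi>] by (rule sum_abs)
  also have "\<dots> \<le> (\<Sum>i<N. \<Sum>j<N. \<bar>A $$ (i, j) * (\<psi> $ i * \<psi> $ j)\<bar>)"
    by (intro sum_mono sum_abs)
  also have "\<dots> \<le> (\<Sum>i<N. \<Sum>j<N. B / 2 * ((\<psi> $ i)\<^sup>2 + (\<psi> $ j)\<^sup>2))"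
    using entry by (intro sum_mono) auto
  also have "\<dots> = B / 2 * ((\<Sum>i<N. \<Sum>j<N. (\<psi> $ i)\<^sup>2) + (\<Sum>i<N. \<Sum>j<N. (\<psi> $ j)\<^sup>2))"
    by (simp only: sum.distrib flip: sum_distrib_left)
  also have "\<dots> = real N * B * (\<Sum>i<N. (\<psi> $ i)\<^sup>2)"
    by (simp flip: sum_distrib_left)
  finally show ?thesis .
qed

lemma sum_squares_pos_vec:
  fixes \<psi> :: "real vec"
  assumes "\<psi> \<in> carrier_vec N" "\<psi> \<noteq> 0\<^sub>v N"
  shows "0 < (\<Sum>i<N. (\<psi> $ i)\<^sup>2)"
proof -
  obtain i where "i < N" "\<psi> $ i \<noteq> 0"
    using assms by (metis carrier_vecD eq_vecI index_zero_vec(1,2))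
  then show ?thesis by (intro sum_pos2[of _ i]) auto
qed

text \<open>The smallest diagonal entry bounds the form of the diagonal part from below, and the
  largest entry of \<open>P\<close> in absolute value bounds the perturbation from above; a small
  \<open>v\<close> keeps the second bound under the first.\<close>

lemma positive_definite_perturbed_diag:
  assumes "\<And>m. 1 \<le> m \<Longrightarrow> m \<le> N \<Longrightarrow> 0 < d m" and P: "P \<in> carrier_mat N N"
  shows "\<exists>v::real. v \<noteq> 0 \<and>
    positive_definite N (tridiag_mat N d (\<lambda>m. 0) (\<lambda>m. 0) + v \<cdot>\<^sub>m P)"
proof -
  let ?D = "tridiag_mat N d (\<lambda>m. 0) (\<lambda>m. 0)"
  \<comment> \<open>Inserting 1 here and 0 below keeps the sets nonempty even for
    \<open>N = 0\<close>; it changes nothing in the bounds needed, as only \<open>0 < c\<close>,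
    \<open>0 \<le> B\<close> and the comparison with the entries matter.\<close>
  define c where "c = Min (insert 1 (d ` {1..N}))"
  define B where "B = Max (insert 0 ((\<lambda>(i, j). \<bar>P $$ (i, j)\<bar>) ` ({..<N} \<times> {..<N})))"
  \<comment> \<open>The summand 1 keeps the denominator positive when \<open>real N * B\<close>
    vanishes, and it makes the inequality \<open>v * (real N * B) < c\<close> strict.\<close>
  define v where "v = c / (real N * B + 1)"
  have c0: "0 < c" using assms(1) by (simp add: c_def)
  have cd: "c \<le> d (i + 1)" if "i < N" for i
    unfolding c_def using that by (intro Min_le) auto
  have B0: "0 \<le> B" unfolding B_def by (intro Max_ge) auto
  have B: "\<bar>P $$ (i, j)\<bar> \<le> B" if "i < N" "j < N" for i j
    unfolding B_def using that by (intro Max_ge) auto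
  have NB: "0 \<le> real N * B" using B0 by simp
  have v0: "0 < v" unfolding v_def using c0 NB by (intro divide_pos_pos) auto
  have vc: "v * (real N * B) < c"
  proof -
    have "v * (real N * B + 1) = c" unfolding v_def using NB by simp
    with v0 show ?thesis by (simp add: algebra_simps)
  qed
  have "0 < \<psi> \<bullet> ((?D + v \<cdot>\<^sub>m P) *\<^sub>v \<psi>)" if \<psi>: "\<psi> \<in> carrier_vec N" "\<psi> \<noteq> 0\<^sub>v N" for \<psi>
  proof -
    define S where "S = (\<Sum>i<N. (\<psi> $ i)\<^sup>2)"
    have S0: "0 < S" unfolding S_def by (rule sum_squares_pos_vec[OF \<psi>])
    have "\<psi> \<bullet> (?D *\<^sub>v \<psi>) = (\<Sum>i<N. \<Sum>j<N. if j = i then d (i + 1) * (\<psi> $ i)\<^sup>2 else 0)"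
      unfolding quadratic_form_eq_sum[OF tridiag_mat_carrier \<psi>(1)]
      by (intro sum.cong) (auto simp: index_tridiag_mat power2_eq_square)
    also have "\<dots> = (\<Sum>i<N. d (i + 1) * (\<psi> $ i)\<^sup>2)"
      by (intro sum.cong) auto
    also have "\<dots> \<ge> c * S"
      unfolding S_def sum_distrib_left using cd by (intro sum_mono mult_right_mono) auto
    finally have D: "c * S \<le> \<psi> \<bullet> (?D *\<^sub>v \<psi>)" .
    have "v * \<bar>\<psi> \<bullet> (P *\<^sub>v \<psi>)\<bar> \<le> v * (real N * B * S)"
      unfolding S_def using v0 B by (intro mult_left_mono abs_quadratic_form_le[OF P \<psi>(1)]) auto
    also have "\<dots> < c * S"
      using mult_strict_right_mono[OF vc S0] by (simp add: mult.assoc)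
    finally have "v * \<bar>\<psi> \<bullet> (P *\<^sub>v \<psi>)\<bar> < \<psi> \<bullet> (?D *\<^sub>v \<psi>)" using D by simp
    moreover have "- (v * (\<psi> \<bullet> (P *\<^sub>v \<psi>))) \<le> v * \<bar>\<psi> \<bullet> (P *\<^sub>v \<psi>)\<bar>"
      using v0 abs_ge_minus_self[of "v * (\<psi> \<bullet> (P *\<^sub>v \<psi>))"] by (simp add: abs_mult)
    ultimately have "0 < \<psi> \<bullet> (?D *\<^sub>v \<psi>) + v * (\<psi> \<bullet> (P *\<^sub>v \<psi>))" by linarith
    also have "\<dots> = \<psi> \<bullet> ((?D + v \<cdot>\<^sub>m P) *\<^sub>v \<psi>)"
    proof -
      have sum: "?D + v \<cdot>\<^sub>m P \<in> carrier_mat N N"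
        using P by auto
      show ?thesis
        unfolding quadratic_form_eq_sum[OF tridiag_mat_carrier \<psi>(1)]
          quadratic_form_eq_sum[OF P \<psi>(1)] quadratic_form_eq_sum[OF sum \<psi>(1)]
          sum_distrib_left sum.distrib[symmetric]
        using P by (intro sum.cong) (auto simp: algebra_simps)
    qed
    finally show ?thesis .
  qed
  then have "positive_definite N (?D + v \<cdot>\<^sub>m P)"
    using P by (simp add: positive_definite_def)
  with v0 show ?thesis by (intro exI[of _ v]) auto
qed

section \<open>Self-adjointness from an intertwining relation\<close>

lemma self_adjoint_wrt_if_intertwined:
  assumes H: "H \<in> carrier_mat N N" and \<Theta>: "\<Theta> \<in> carrier_mat N N" and eq: "H\<^sup>T * \<Theta> = \<Theta> * H"
  shows "self_adjoint_wrt N \<Theta> H"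
  unfolding self_adjoint_wrt_def inner_S_def
proof (intro ballI)
  fix \<psi> \<phi> :: "real vec"
  assume \<psi>: "\<psi> \<in> carrier_vec N" and \<phi>: "\<phi> \<in> carrier_vec N"
  have "\<Theta> *\<^sub>v (H *\<^sub>v \<phi>) = (H\<^sup>T * \<Theta>) *\<^sub>v \<phi>"
    using H \<Theta> \<phi> by (simp add: eq)
  also have "\<dots> = H\<^sup>T *\<^sub>v (\<Theta> *\<^sub>v \<phi>)"
    using H \<Theta> \<phi> by (intro assoc_mult_mat_vec) auto
  \<comment> \<open>The factors are swapped so that the transpose acts on the left one, where
    \<open>transpose_vec_mult_scalar\<close> moves it to the other side as \<open>H\<close>.\<close>
  finally have "\<psi> \<bullet> (\<Theta> *\<^sub>v (H *\<^sub>v \<phi>)) = (H\<^sup>T *\<^sub>v (\<Theta> *\<^sub>v \<phi>)) \<bullet> \<psi>"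
    using H \<Theta> \<psi> \<phi> by (simp add: comm_scalar_prod[of \<psi> N])
  also have "\<dots> = (\<Theta> *\<^sub>v \<phi>) \<bullet> (H *\<^sub>v \<psi>)"
    using H \<Theta> \<psi> \<phi> by (intro transpose_vec_mult_scalar) auto
  also have "\<dots> = (H *\<^sub>v \<psi>) \<bullet> (\<Theta> *\<^sub>v \<phi>)"
    using H \<Theta> \<psi> \<phi> by (intro comm_scalar_prod[of _ N]) auto
  finally show "\<psi> \<bullet> (\<Theta> *\<^sub>v (H *\<^sub>v \<phi>)) = (H *\<^sub>v \<psi>) \<bullet> (\<Theta> *\<^sub>v \<phi>)" .
qed

section \<open>Diagonal and off-diagonal coefficients of the metric\<close>

definition D_coeff :: "nat \<Rightarrow> nat \<Rightarrow> (nat \<Rightarrow> real) \<Rightarrow> nat \<Rightarrow> real" where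
  "D_coeff N k lam m =
     (if m \<le> k then \<Prod>i=m..k. f_fun (lam i)
      else if N + 1 - m \<le> k then \<Prod>i=N + 1 - m..k. f_fun (lam i)
      else 1)"

lemma Theta_diag_eq: "Theta_diag N k lam = tridiag_mat N (D_coeff N k lam) (\<lambda>m. 0) (\<lambda>m. 0)"
  by (simp add: Theta_diag_def D_coeff_def[abs_def])

lemma f_fun_pos: "\<bar>x\<bar> < 1 \<Longrightarrow> 0 < f_fun x"
  by (auto simp: f_fun_def intro!: divide_pos_pos)

lemma D_coeff_pos:
  assumes "\<forall>j \<in> {1..k}. \<bar>lam j\<bar> < 1" "1 \<le> m" "m \<le> N"
  shows "0 < D_coeff N k lam m"
  using assms by (auto simp: D_coeff_def intro!: prod_pos f_fun_pos)

text \<open>Serves to separate the metric from the identity: for nonzero \<open>v\<close> its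
  off-diagonal entries cannot vanish.\<close>

lemma P_coeff_pos:
  assumes "\<forall>j \<in> {1..k}. \<bar>lam j\<bar> < 1" "1 \<le> m" "m < N"
  shows "0 < P_coeff N k lam m"
proof -
  have "0 < 1 + lam j" if "j \<in> {1..k}" for j
  proof -
    have "\<bar>lam j\<bar> < 1" using assms(1) that by blast
    then show ?thesis by linarith
  qed
  then show ?thesis
    using assms by (auto simp: P_coeff_def intro!: mult_pos_pos prod_pos f_fun_pos)
qed

text \<open>The denominator of the first factor \<open>f_fun (lam j)\<close> cancels against
  \<open>1 + lam j\<close>. This cancellation is what makes the diagonal scaling of
  \<open>Hmat\<close> symmetric.\<close>

lemma prod_f_fun_step:
  assumes "j \<le> k" "1 + lam j \<noteq> 0"
  shows "(1 + lam j) * (\<Prod>i=j..k. f_fun (lam i)) = (1 - lam j) * (\<Prod>i=Suc j..k. f_fun (lam i))"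
  using assms by (simp add: prod.atLeast_Suc_atMost f_fun_def)

text \<open>The range reaches one position past the left block: at \<open>m = Suc k\<close> the
  empty product agrees with the middle value 1, so the coupling between positions \<open>k\<close>
  and \<open>k + 1\<close> needs no separate case.\<close>

lemma D_coeff_left:
  assumes "2 * k + 1 \<le> N" "m \<le> Suc k"
  shows "D_coeff N k lam m = (\<Prod>i=m..k. f_fun (lam i))"
  using assms by (cases "m = Suc k") (auto simp: D_coeff_def)

text \<open>Mirror image of \<open>D_coeff_left\<close>, with the empty product at
  \<open>m = N - k\<close>.\<close>

lemma D_coeff_right:
  assumes "2 * k + 1 \<le> N" "N - m \<le> k" "m \<le> N"
  shows "D_coeff N k lam m = (\<Prod>i=Suc (N - m)..k. f_fun (lam i))"
  using assms by (cases "N - m = k") (auto simp: D_coeff_def Suc_diff_le)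

lemma D_coeff_middle:
  assumes "k < m" "k < N - m"
  shows "D_coeff N k lam m = 1" "D_coeff N k lam (Suc m) = 1"
  using assms by (auto simp: D_coeff_def)

section \<open>Matrix identities linking \<open>Hmat\<close>, \<open>Theta_diag\<close> and
  \<open>Pmat\<close>\<close>

context
  fixes N k :: nat and lam :: "nat \<Rightarrow> real"
  assumes N: "2 * k + 1 \<le> N" and lam: "\<forall>j \<in> {1..k}. \<bar>lam j\<bar> < 1"
begin

lemma one_plus_lam_nonzero: "1 \<le> j \<Longrightarrow> j \<le> k \<Longrightarrow> 1 + lam j \<noteq> 0"
  using lam[rule_format, of j] by auto

text \<open>Superdiagonal part of \<open>D H = 2 D - P\<close>. In the left block both sides carry
  the same product; in the right block the product in \<open>D\<close> starts one index later than
  the one in \<open>P\<close>, and \<open>prod_f_fun_step\<close> bridges the gap.\<close>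

lemma D_coeff_upper:
  assumes "1 \<le> m" "m < N"
  shows "D_coeff N k lam m *
    (if m \<le> k then - 1 - lam m else if N - m \<le> k then - 1 + lam (N - m) else - 1) =
    - P_coeff N k lam m"
proof -
  consider "m \<le> k" | "k < m" "N - m \<le> k" | "k < m" "k < N - m" by linarith
  then show ?thesis
  proof cases
    case 1
    then show ?thesis
      using D_coeff_left[OF N, of m lam] by (simp add: P_coeff_def algebra_simps)
  next
    case 2
    then show ?thesis
      using assms D_coeff_right[OF N, of m lam] prod_f_fun_step[of "N - m" k lam]
        one_plus_lam_nonzero[of "N - m"]
      by (simp add: P_coeff_def algebra_simps)
  next
    case 3
    then show ?thesis by (simp add: P_coeff_def D_coeff_middle)
  qed
qed

text \<open>Subdiagonal counterpart. Since row \<open>Suc m\<close> is scaled, the two blocks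
  exchange roles and the left one requires \<open>prod_f_fun_step\<close>.\<close>

lemma D_coeff_lower:
  assumes "1 \<le> m" "m < N"
  shows "D_coeff N k lam (Suc m) *
    (if m \<le> k then - 1 + lam m else if N - m \<le> k then - 1 - lam (N - m) else - 1) =
    - P_coeff N k lam m"
proof -
  consider "m \<le> k" | "k < m" "N - m \<le> k" | "k < m" "k < N - m" by linarith
  then show ?thesis
  proof cases
    case 1
    then show ?thesis
      using assms D_coeff_left[OF N, of "Suc m" lam] prod_f_fun_step[of m k lam]
        one_plus_lam_nonzero[of m]
      by (simp add: P_coeff_def algebra_simps)
  next
    case 2
    \<comment> \<open>\<open>Suc (N - Suc m)\<close> equals \<open>N - m\<close>, so the product
      already starts where the one in \<open>P_coeff\<close> does.\<close>
    then show ?thesis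
      using assms D_coeff_right[OF N, of "Suc m" lam]
      by (simp add: P_coeff_def Suc_diff_Suc algebra_simps)
  next
    case 3
    then show ?thesis by (simp add: P_coeff_def D_coeff_middle)
  qed
qed

text \<open>Left multiplication by a diagonal matrix scales rows: the constant diagonal 2 of
  \<open>Hmat\<close> yields \<open>2 D\<close>, and the two preceding lemmas turn the off-diagonals
  into \<open>- P\<close>.\<close>

lemma Theta_diag_mult_Hmat:
  "Theta_diag N k lam * Hmat N k lam = 2 \<cdot>\<^sub>m Theta_diag N k lam - Pmat N k lam"
proof (rule eq_matI)
  fix i j
  assume "i < dim_row (2 \<cdot>\<^sub>m Theta_diag N k lam - Pmat N k lam)"
    "j < dim_col (2 \<cdot>\<^sub>m Theta_diag N k lam - Pmat N k lam)"
  then have ij: "i < N" "j < N" by (auto simp: Theta_diag_eq Pmat_def)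
  consider "j = i" | "j = Suc i" | "i = Suc j" | "j \<noteq> i" "j \<noteq> Suc i" "i \<noteq> Suc j" by blast
  then show "(Theta_diag N k lam * Hmat N k lam) $$ (i, j) =
      (2 \<cdot>\<^sub>m Theta_diag N k lam - Pmat N k lam) $$ (i, j)"
    unfolding Theta_diag_eq Hmat_def Pmat_def diag_mult_index[OF ij tridiag_mat_carrier]
    \<comment> \<open>Entries are 0-based and coefficients 1-based: \<open>(i, Suc i)\<close>
      carries position \<open>Suc i\<close>, and \<open>(Suc j, j)\<close> carries position
      \<open>Suc j\<close>.\<close>
    using ij D_coeff_upper[of "Suc i"] D_coeff_lower[of "Suc j"]
    by cases (auto simp: index_tridiag_mat)
qed (simp_all add: Theta_diag_eq Hmat_def Pmat_def)

text \<open>As \<open>D\<close> is symmetric, the left side is the transpose of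
  \<open>D H = 2 D - P\<close>, which is symmetric itself.\<close>

lemma Hmat_Theta_diag:
  "(Hmat N k lam)\<^sup>T * Theta_diag N k lam = Theta_diag N k lam * Hmat N k lam"
proof -
  have [simp]: "Theta_diag N k lam \<in> carrier_mat N N" "Hmat N k lam \<in> carrier_mat N N"
    by (simp_all add: Theta_diag_eq Hmat_def)
  have D: "(Theta_diag N k lam)\<^sup>T = Theta_diag N k lam" and P: "(Pmat N k lam)\<^sup>T = Pmat N k lam"
    by (simp_all add: Theta_diag_eq Pmat_def transpose_tridiag_mat)
  have "(Hmat N k lam)\<^sup>T * Theta_diag N k lam = (Theta_diag N k lam * Hmat N k lam)\<^sup>T"
    by (subst transpose_mult[of _ N N _ N]) (simp_all add: D)
  also have "\<dots> = 2 \<cdot>\<^sub>m (Theta_diag N k lam)\<^sup>T - (Pmat N k lam)\<^sup>T"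
    unfolding Theta_diag_mult_Hmat by (rule eq_matI) (simp_all add: Theta_diag_eq Pmat_def)
  finally show ?thesis by (simp add: D P Theta_diag_mult_Hmat)
qed

text \<open>Solving \<open>D H = 2 D - P\<close> for \<open>P\<close> and substituting into
  \<open>D + v P\<close> pulls out \<open>D\<close> on the left.\<close>

lemma Theta_tridiag_eq_diag_mult:
  "Theta_tridiag N k lam v =
    Theta_diag N k lam * ((1 + 2 * v) \<cdot>\<^sub>m 1\<^sub>m N - v \<cdot>\<^sub>m Hmat N k lam)"
proof -
  let ?D = "Theta_diag N k lam" and ?H = "Hmat N k lam" and ?P = "Pmat N k lam"
  have [simp]: "?D \<in> carrier_mat N N" "?H \<in> carrier_mat N N" "?P \<in> carrier_mat N N"
    by (simp_all add: Theta_diag_eq Hmat_def Pmat_def)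
  have "?D * ((1 + 2 * v) \<cdot>\<^sub>m 1\<^sub>m N - v \<cdot>\<^sub>m ?H) =
      ?D * ((1 + 2 * v) \<cdot>\<^sub>m 1\<^sub>m N) - ?D * (v \<cdot>\<^sub>m ?H)"
    by (rule mult_minus_distrib_mat[of _ N N _ N]) simp_all
  also have "\<dots> = (1 + 2 * v) \<cdot>\<^sub>m ?D - v \<cdot>\<^sub>m (?D * ?H)"
    by (simp add: mult_smult_distrib[of _ N N _ N] right_mult_one_mat[of _ N N])
  also have "\<dots> = Theta_tridiag N k lam v"
    unfolding Theta_diag_mult_Hmat Theta_tridiag_def
    by (rule eq_matI) (simp_all add: Theta_diag_eq Pmat_def algebra_simps)
  finally show ?thesis ..
qed

text \<open>The right factor \<open>Q\<close> is affine in \<open>H\<close> and so commutes with it.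
  Moving \<open>H\<close> first past \<open>D\<close>, where its transpose is absorbed, and then
  past \<open>Q\<close> gives the claim.\<close>

lemma Hmat_Theta_tridiag:
  "(Hmat N k lam)\<^sup>T * Theta_tridiag N k lam v = Theta_tridiag N k lam v * Hmat N k lam"
proof -
  let ?D = "Theta_diag N k lam" and ?H = "Hmat N k lam"
  let ?Q = "(1 + 2 * v) \<cdot>\<^sub>m 1\<^sub>m N - v \<cdot>\<^sub>m ?H"
  have [simp]: "?D \<in> carrier_mat N N" and H [simp]: "?H \<in> carrier_mat N N"
    by (simp_all add: Theta_diag_eq Hmat_def)
  have Q [simp]: "?Q \<in> carrier_mat N N" 
    by (intro minus_carrier_mat smult_carrier_mat H)
  have "?H * ?Q = (1 + 2 * v) \<cdot>\<^sub>m ?H - v \<cdot>\<^sub>m (?H * ?H)"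
    by (subst mult_minus_distrib_mat[of _ N N _ N]) 
      (simp_all add: mult_smult_distrib[of _ N N _ N] right_mult_one_mat[of _ N N])
  also have "\<dots> = ?Q * ?H"
    by (subst minus_mult_distrib_mat[of _ N N _ _ N])
      (simp_all add: mult_smult_assoc_mat[of _ N N _ N] left_mult_one_mat[of _ N N])
  finally have comm: "?H * ?Q = ?Q * ?H" .
  have "?H\<^sup>T * (?D * ?Q) = (?H\<^sup>T * ?D) * ?Q"
    by (rule assoc_mult_mat[symmetric, of _ N N _ N _ N]) simp_all
  also have "\<dots> = ?D * (?H * ?Q)"
    unfolding Hmat_Theta_diag by (rule assoc_mult_mat[of _ N N _ N _ N]) simp_all
  also have "\<dots> = (?D * ?Q) * ?H"
    unfolding comm by (rule assoc_mult_mat[symmetric, of _ N N _ N _ N]) simp_all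
  finally show ?thesis unfolding Theta_tridiag_eq_diag_mult .
qed

end

section \<open>Symmetry of the metric and conclusion\<close>

lemma transpose_Theta_tridiag: "(Theta_tridiag N k lam v)\<^sup>T = Theta_tridiag N k lam v"
  by (rule eq_matI) (auto simp: Theta_tridiag_def Theta_diag_eq Pmat_def index_tridiag_mat)

theorem proposition2:
  fixes N k :: nat and lam :: "nat \<Rightarrow> real"
  assumes "k \<ge> 1" and "N \<ge> 2 * k + 1"
    and "\<forall>j \<in> {1..k}. \<bar>lam j\<bar> < 1"
  shows "(\<forall>v::real. positive_definite N (Theta_tridiag N k lam v) \<longrightarrow>
            is_metric N (Theta_tridiag N k lam v) \<and>
            self_adjoint_wrt N (Theta_tridiag N k lam v) (Hmat N k lam) \<and>
            (Hmat N k lam)\<^sup>T * Theta_tridiag N k lam v = Theta_tridiag N k lam v * Hmat N k lam) \<and>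
         (\<exists>v::real. v \<noteq> 0 \<and> is_metric N (Theta_tridiag N k lam v)) \<and>
         (\<forall>v::real. v \<noteq> 0 \<longrightarrow> Theta_tridiag N k lam v \<noteq> 1\<^sub>m N)"
proof (intro conjI allI impI)
  fix v :: real
  show intertwined: "(Hmat N k lam)\<^sup>T * Theta_tridiag N k lam v =
      Theta_tridiag N k lam v * Hmat N k lam"
    by (rule Hmat_Theta_tridiag[OF assms(2,3)])
  show "self_adjoint_wrt N (Theta_tridiag N k lam v) (Hmat N k lam)"
    by (rule self_adjoint_wrt_if_intertwined[OF _ _ intertwined])
      (simp_all add: Hmat_def Theta_tridiag_def Theta_diag_eq Pmat_def)
  show "is_metric N (Theta_tridiag N k lam v)" if "positive_definite N (Theta_tridiag N k lam v)"
    using that by (simp add: is_metric_def transpose_Theta_tridiag)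
next
  have "\<exists>v::real. v \<noteq> 0 \<and> positive_definite N (Theta_tridiag N k lam v)"
    unfolding Theta_tridiag_def Theta_diag_eq
    by (rule positive_definite_perturbed_diag[OF D_coeff_pos[OF assms(3)]]) (simp_all add: Pmat_def)
  then show "\<exists>v::real. v \<noteq> 0 \<and> is_metric N (Theta_tridiag N k lam v)"
    by (simp add: is_metric_def transpose_Theta_tridiag)
next
  fix v :: real
  assume "v \<noteq> 0"
  \<comment> \<open>The entry next to the corner tells the two matrices apart; it exists because
    \<open>N\<close> is at least 3.\<close>
  moreover have "Theta_tridiag N k lam v $$ (0, 1) = v * P_coeff N k lam 1"
    using assms by (simp add: Theta_tridiag_def Theta_diag_eq Pmat_def index_tridiag_mat)
  moreover have "0 < P_coeff N k lam 1"
    using assms by (intro P_coeff_pos) auto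
  moreover have "(1\<^sub>m N :: real mat) $$ (0, 1) = 0"
    using assms by simp
  ultimately show "Theta_tridiag N k lam v \<noteq> 1\<^sub>m N" by auto
qed

end
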